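(* Let $k$ be a field and let $\mathcal{H}=(\mathcal{X},\mathcal{E})$ be a simple hypergraph with two or more edges. Then an edge $E\in\mathcal{E}$ is a splitting edge of $\mathcal{H}$ if and only if there exists a vertex $z\in E$ such that $$(x^E)\cap \mathcal{I}(\mathcal{H}\setminus E)\subseteq (x^E)\cap\mathcal{I}(\mathcal{H}\setminus\{z\}).$$
   Context: A simple hypergraph $\mathcal{H}=(\mathcal{X},\mathcal{E})$ consists of a finite set $\mathcal{X}=\{x_1,\dots,x_n\}$ of vertices and a family $\mathcal{E}$ of distinct subsets of $\mathcal{X}$ (edges) with $|E|\ge 2$ for all $E\in\mathcal{E}$ and no edge contained in a different edge. Identify vertices with the variables of $R=k[x_1,\dots,x_n]$, put $x^E=\prod_{x\in E}x$, and let the edge ideal be $\mathcal{I}(\mathcal{H})=(x^E : E\in\mathcal{E})\subseteq R$. For an edge $E$, $\mathcal{H}\setminus E$ is $\mathcal{H}$ with the edge $E$ removed (same vertices); for a vertex $z$, $\mathcal{H}\setminus\{z\}$ is the hypergraph obtained by removing every edge containing $z$. Edge ideals of these are taken in $R$. For a monomial ideal $I$ let $\mathcal{G}(I)$ be its minimal set of monomial generators. An expression $I=J+K$ with $J,K$ nonzero monomial ideals is a splitting of $I$ if (1) $\mathcal{G}(I)$ is the disjoint union of $\mathcal{G}(J)$ and $\mathcal{G}(K)$; and (2) there is a function $\mathcal{G}(J\cap K)\to\mathcal{G}(J)\times\mathcal{G}(K)$, $w\mapsto(\phi(w),\psi(w))$, such that (a) $w=\operatorname{lcm}(\phi(w),\psi(w))$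 for all $w\in\mathcal{G}(J\cap K)$, and (b) for every nonempty subset $S\subseteq\mathcal{G}(J\cap K)$, both $\operatorname{lcm}(\phi(S))$ and $\operatorname{lcm}(\psi(S))$ strictly divide $\operatorname{lcm}(S)$. An edge $E$ is a splitting edge of $\mathcal{H}$ if $\mathcal{I}(\mathcal{H})=(x^E)+\mathcal{I}(\mathcal{H}\setminus E)$ is a splitting of $\mathcal{I}(\mathcal{H})$. *)

theory Defs
  imports Complex_Main "HOL-Library.Poly_Mapping" "HOL-Library.Set_Algebras"
begin

text \<open>
  The vertex set is the universe of a finite type \<^typ>\<open>'x\<close>. A monomial is given by its exponent
  vector, of type \<^typ>\<open>'x \<Rightarrow>\<^sub>0 nat\<close>, and the polynomial ring \<open>R\<close> with one variable per vertex is
  the type below, with the convolution product of \<^theory>\<open>HOL-Library.Poly_Mapping\<close>.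
\<close>

type_synonym 'x monomial = "'x \<Rightarrow>\<^sub>0 nat"
type_synonym ('x, 'k) mvpoly = "('x \<Rightarrow>\<^sub>0 nat) \<Rightarrow>\<^sub>0 'k"

definition mon :: "'x monomial \<Rightarrow> ('x, 'k::field) mvpoly" where
  "mon m = Poly_Mapping.single m 1"

text \<open>Exponent vectors are written additively, so this is divisibility of monomials.\<close>

definition mon_dvd :: "'x monomial \<Rightarrow> 'x monomial \<Rightarrow> bool" where
  "mon_dvd m n \<longleftrightarrow> (\<exists>u. n = m + u)"

definition mon_strict_dvd :: "'x monomial \<Rightarrow> 'x monomial \<Rightarrow> bool" where
  "mon_strict_dvd m n \<longleftrightarrow> mon_dvd m n \<and> m \<noteq> n"

text \<open>
  The least common multiple of a finite set of monomials. On \<^typ>\<open>nat\<close> the supremum of a finite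
  nonempty set is its maximum, and the supremum of the empty set is 0.
\<close>

definition mon_lcm :: "'x::finite monomial set \<Rightarrow> 'x monomial" where
  "mon_lcm S = Abs_poly_mapping (\<lambda>x. SUP m\<in>S. Poly_Mapping.lookup m x)"

definition ideal_gen :: "'a::comm_ring_1 set \<Rightarrow> 'a set" where
  "ideal_gen B = module.span (*) B"

definition monomial_ideal :: "('x, 'k::field) mvpoly set \<Rightarrow> bool" where
  "monomial_ideal I \<longleftrightarrow> (\<exists>M. I = ideal_gen (mon ` M))"

definition is_min_gens :: "'x monomial set \<Rightarrow> ('x, 'k::field) mvpoly set \<Rightarrow> bool" where
  "is_min_gens M I \<longleftrightarrow> ideal_gen (mon ` M) = I \<and> (\<forall>N. N \<subset> M \<longrightarrow> ideal_gen (mon ` N) \<noteq> I)"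

text \<open>Existence and uniqueness, for monomial ideals, are shown in \<open>min_gens\<close> below.\<close>

definition min_gens :: "('x, 'k::field) mvpoly set \<Rightarrow> 'x monomial set" where
  "min_gens I = (THE M. is_min_gens M I)"

definition is_splitting ::
  "('x::finite, 'k::field) mvpoly set \<Rightarrow> ('x, 'k) mvpoly set \<Rightarrow> ('x, 'k) mvpoly set \<Rightarrow> bool" where
  "is_splitting I J K \<longleftrightarrow>
     monomial_ideal J \<and> monomial_ideal K \<and> J \<noteq> {0} \<and> K \<noteq> {0} \<and> I = J + K \<and>
     min_gens I = min_gens J \<union> min_gens K \<and> min_gens J \<inter> min_gens K = {} \<and>
     (\<exists>\<phi> \<psi>.
        (\<forall>w \<in> min_gens (J \<inter> K).
           \<phi> w \<in> min_gens J \<and> \<psi> w \<in> min_gens K \<and> w = mon_lcm {\<phi> w, \<psi> w}) \<and>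
        (\<forall>S. S \<subseteq> min_gens (J \<inter> K) \<and> S \<noteq> {} \<longrightarrow>
           mon_strict_dvd (mon_lcm (\<phi> ` S)) (mon_lcm S) \<and>
           mon_strict_dvd (mon_lcm (\<psi> ` S)) (mon_lcm S)))"

text \<open>A hypergraph on the vertex set \<^term>\<open>UNIV :: 'x::finite set\<close> is given by its set of edges.\<close>

definition simple_hypergraph :: "'x::finite set set \<Rightarrow> bool" where
  "simple_hypergraph H \<longleftrightarrow>
     (\<forall>E \<in> H. card E \<ge> 2) \<and> (\<forall>E \<in> H. \<forall>F \<in> H. E \<subseteq> F \<longrightarrow> E = F)"

definition delete_edge :: "'x set set \<Rightarrow> 'x set \<Rightarrow> 'x set set" where
  "delete_edge H E = H - {E}"

definition delete_vertex :: "'x set set \<Rightarrow> 'x \<Rightarrow> 'x set set" where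
  "delete_vertex H z = {F \<in> H. z \<notin> F}"

definition edge_monomial :: "'x::finite set \<Rightarrow> 'x monomial" where
  "edge_monomial E = (\<Sum>x\<in>E. Poly_Mapping.single x 1)"

definition edge_ideal :: "'x::finite set set \<Rightarrow> ('x, 'k::field) mvpoly set" where
  "edge_ideal H = ideal_gen ((\<lambda>E. mon (edge_monomial E)) ` H)"

text \<open>The first argument only fixes the coefficient field.\<close>

definition splitting_edge :: "'k::field itself \<Rightarrow> 'x::finite set set \<Rightarrow> 'x set \<Rightarrow> bool" where
  "splitting_edge _ H E \<longleftrightarrow> E \<in> H \<and>
     is_splitting (edge_ideal H :: ('x, 'k) mvpoly set)
       (ideal_gen {mon (edge_monomial E)}) (edge_ideal (delete_edge H E))"


lemma mon_dvd_iff: "mon_dvd m n \<longleftrightarrow> (\<forall>x. Poly_Mapping.lookup m x \<le> Poly_Mapping.lookup n x)"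
proof
  show "mon_dvd m n \<Longrightarrow> \<forall>x. Poly_Mapping.lookup m x \<le> Poly_Mapping.lookup n x"
    by (auto simp: mon_dvd_def lookup_add)
  assume *: "\<forall>x. Poly_Mapping.lookup m x \<le> Poly_Mapping.lookup n x"
  have "n = m + (n - m)"
    by (rule poly_mapping_eqI) (use * in \<open>simp add: lookup_add lookup_minus\<close>)
  then show "mon_dvd m n" unfolding mon_dvd_def by blast
qed

lemma lookup_mon_lcm:
  "Poly_Mapping.lookup (mon_lcm S) x = (SUP m\<in>S. Poly_Mapping.lookup m x)"
  unfolding mon_lcm_def by (simp add: Abs_poly_mapping_inverse)

lemma mon_lcm_dvd_iff:
  fixes n :: "'x::finite monomial"
  assumes "finite S"
  shows "mon_dvd (mon_lcm S) n \<longleftrightarrow> (\<forall>m\<in>S. mon_dvd m n)"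
proof (cases "S = {}")
  case True
  then show ?thesis by (simp add: mon_dvd_iff lookup_mon_lcm)
next
  case False
  have "(SUP m\<in>S. Poly_Mapping.lookup m x) \<le> k \<longleftrightarrow> (\<forall>m\<in>S. Poly_Mapping.lookup m x \<le> k)"
    for x k using assms False by (simp add: cSup_eq_Max)
  then show ?thesis by (auto simp: mon_dvd_iff lookup_mon_lcm)
qed

lemma module_mult: "module ((*) :: 'a::comm_ring_1 \<Rightarrow> 'a \<Rightarrow> 'a)"
  by standard (simp_all add: algebra_simps)

lemma mon_mult: "mon m * mon n = mon (m + n)"
  by (simp add: mon_def mult_single)

lemma keys_mult_mon:
  assumes "n \<in> Poly_Mapping.keys (p * q)"
  shows "\<exists>b\<in>Poly_Mapping.keys q. mon_dvd b n"
proof -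
  obtain a b where "n = a + b" "b \<in> Poly_Mapping.keys q"
    using keys_mult[of p q] assms by blast
  moreover from this have "mon_dvd b n" by (simp add: mon_dvd_iff lookup_add)
  ultimately show ?thesis by blast
qed

lemma mon_dvd_trans: "mon_dvd a b \<Longrightarrow> mon_dvd b c \<Longrightarrow> mon_dvd a c"
  by (auto simp: mon_dvd_def add.assoc)

lemma mon_in_ideal_gen_iff:
  "(mon m :: ('x, 'k::field) mvpoly) \<in> ideal_gen (mon ` A) \<longleftrightarrow> (\<exists>a\<in>A. mon_dvd a m)"
proof -
  interpret I: module "(*) :: ('x, 'k) mvpoly \<Rightarrow> _" by (rule module_mult)
  let ?P = "{p :: ('x, 'k) mvpoly. \<forall>n\<in>Poly_Mapping.keys p. \<exists>a\<in>A. mon_dvd a n}"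
  have P: "I.subspace ?P"
  proof (rule I.subspaceI)
    show "0 \<in> ?P" by simp
    show "p + q \<in> ?P" if "p \<in> ?P" "q \<in> ?P" for p q
      using that keys_add[of p q] by blast
    show "c * p \<in> ?P" if p: "p \<in> ?P" for c p
    proof (rule CollectI, rule ballI)
      fix n assume "n \<in> Poly_Mapping.keys (c * p)"
      then obtain b where b: "b \<in> Poly_Mapping.keys p" "mon_dvd b n"
        using keys_mult_mon by blast
      with p obtain a where a: "a \<in> A" "mon_dvd a b" by blast
      from a(2) b(2) have "mon_dvd a n" by (rule mon_dvd_trans)
      with a show "\<exists>a\<in>A. mon_dvd a n" by blast
    qed
  qed
  have "mon ` A \<subseteq> ?P"
    by (auto simp: mon_def mon_dvd_iff)
  then have sub: "ideal_gen (mon ` A) \<subseteq> ?P"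
    unfolding ideal_gen_def using P by (rule I.span_minimal)
  show ?thesis
  proof
    assume "(mon m :: ('x, 'k) mvpoly) \<in> ideal_gen (mon ` A)"
    with sub have "(mon m :: ('x, 'k) mvpoly) \<in> ?P" by (rule subsetD)
    then show "\<exists>a\<in>A. mon_dvd a m" by (simp add: mon_def)
  next
    assume "\<exists>a\<in>A. mon_dvd a m"
    then obtain a u where au: "a \<in> A" "m = a + u" by (auto simp: mon_dvd_def)
    have "mon u * mon a \<in> I.span (mon ` A)"
      using au by (intro I.span_scale I.span_base) simp
    with au show "(mon m :: ('x, 'k) mvpoly) \<in> ideal_gen (mon ` A)"
      by (simp add: ideal_gen_def mon_mult add.commute)
  qed
qed

lemma ideal_gen_mon_subset_iff:
  "ideal_gen (mon ` A :: ('x, 'k::field) mvpoly set) \<subseteq> ideal_gen (mon ` B) \<longleftrightarrow>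
     (\<forall>a\<in>A. \<exists>b\<in>B. mon_dvd b a)"
proof -
  interpret I: module "(*) :: ('x, 'k) mvpoly \<Rightarrow> _" by (rule module_mult)
  have "ideal_gen (mon ` A :: ('x, 'k) mvpoly set) \<subseteq> ideal_gen (mon ` B) \<longleftrightarrow>
      mon ` A \<subseteq> (ideal_gen (mon ` B) :: ('x, 'k) mvpoly set)"
    unfolding ideal_gen_def
  proof
    assume "I.span (mon ` A) \<subseteq> I.span (mon ` B)"
    with I.span_superset show "mon ` A \<subseteq> I.span (mon ` B)" by (rule subset_trans)
  next
    assume "mon ` A \<subseteq> I.span (mon ` B)"
    then show "I.span (mon ` A) \<subseteq> I.span (mon ` B)"
      by (rule I.span_minimal) (rule I.subspace_span)
  qed
  then show ?thesis by (auto simp: mon_in_ideal_gen_iff)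
qed

lemma mon_dvd_antisym: "mon_dvd a b \<Longrightarrow> mon_dvd b a \<Longrightarrow> a = b"
  by (auto simp: mon_dvd_iff intro!: poly_mapping_eqI antisym)

lemma mon_dvd_refl: "mon_dvd a a"
  by (simp add: mon_dvd_iff)

lemma ex_minimal_divisor:
  fixes m :: "'x::finite monomial"
  assumes "m \<in> A"
  shows "\<exists>a\<in>A. mon_dvd a m \<and> (\<forall>b\<in>A. mon_dvd b a \<longrightarrow> b = a)"
proof -
  let ?d = "\<lambda>a. \<Sum>x\<in>UNIV. Poly_Mapping.lookup a x"
  define a where "a = arg_min ?d (\<lambda>a. a \<in> A \<and> mon_dvd a m)"
  have a: "a \<in> A \<and> mon_dvd a m"
    and le: "\<And>b. b \<in> A \<and> mon_dvd b m \<Longrightarrow> ?d a \<le> ?d b"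
    unfolding a_def
    using arg_min_nat_lemma[of "\<lambda>a. a \<in> A \<and> mon_dvd a m" m ?d] assms mon_dvd_refl[of m] by blast+
  have "b = a" if b: "b \<in> A" "mon_dvd b a" for b
  proof -
    obtain u where u: "a = b + u" using b by (auto simp: mon_dvd_def)
    have "mon_dvd b m" using b a mon_dvd_trans[of b a m] by simp
    with b have "?d a \<le> ?d b" using le by simp
    then have "?d u = 0" by (simp add: u lookup_add sum.distrib)
    then have "u = 0" by (intro poly_mapping_eqI) simp
    then show ?thesis using u by simp
  qed
  with a show ?thesis by blast
qed

lemma min_gens_unique:
  assumes M: "is_min_gens M (I :: ('x, 'k::field) mvpoly set)" and N: "is_min_gens N I"
  shows "M \<subseteq> N"
proof
  fix a assume a: "a \<in> M"
  have MN: "\<forall>a\<in>M. \<exists>b\<in>N. mon_dvd b a" "\<forall>b\<in>N. \<exists>a\<in>M. mon_dvd a b"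
    using M N ideal_gen_mon_subset_iff[of M N, where 'k='k]
      ideal_gen_mon_subset_iff[of N M, where 'k='k]
    unfolding is_min_gens_def by simp_all
  obtain b where b: "b \<in> N" "mon_dvd b a" using MN a by blast
  obtain c where c: "c \<in> M" "mon_dvd c b" using MN b by blast
  have "c = a"
  proof (rule ccontr)
    assume ne: "c \<noteq> a"
    have "\<forall>x\<in>M. \<exists>y\<in>M - {a}. mon_dvd y x"
    proof
      fix x assume x: "x \<in> M"
      show "\<exists>y\<in>M - {a}. mon_dvd y x"
      proof (cases "x = a")
        case True
        have "mon_dvd c a" using c(2) b(2) by (rule mon_dvd_trans)
        with True c(1) ne show ?thesis by blast
      next
        case False
        with x mon_dvd_refl[of x] show ?thesis by blast
      qed
    qed
    then have "ideal_gen (mon ` M :: ('x, 'k) mvpoly set) \<subseteq> ideal_gen (mon ` (M - {a}))"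
      by (simp only: ideal_gen_mon_subset_iff)
    moreover have "ideal_gen (mon ` (M - {a}) :: ('x, 'k) mvpoly set) \<subseteq> ideal_gen (mon ` M)"
      using mon_dvd_refl by (subst ideal_gen_mon_subset_iff) blast
    ultimately have "ideal_gen (mon ` (M - {a})) = I"
      using M by (auto simp: is_min_gens_def)
    moreover have "M - {a} \<subset> M" using a by blast
    ultimately show False using M unfolding is_min_gens_def by blast
  qed
  with b c have "b = a" using mon_dvd_antisym[of a b] by simp
  with b show "a \<in> N" by simp
qed

lemma min_gens:
  fixes I :: "('x::finite, 'k::field) mvpoly set"
  assumes "monomial_ideal I"
  shows "\<exists>!M. is_min_gens M I" and "is_min_gens (min_gens I) I"
proof -
  obtain A where A: "I = ideal_gen (mon ` A)" using assms by (auto simp: monomial_ideal_def)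
  define M where "M = {a\<in>A. \<forall>b\<in>A. mon_dvd b a \<longrightarrow> b = a}"
  have "\<forall>a\<in>A. \<exists>b\<in>M. mon_dvd b a"
  proof
    fix a assume "a \<in> A"
    from ex_minimal_divisor[OF this] show "\<exists>b\<in>M. mon_dvd b a" unfolding M_def by blast
  qed
  then have sub: "I \<subseteq> ideal_gen (mon ` M)"
    unfolding A by (subst ideal_gen_mon_subset_iff)
  have "ideal_gen (mon ` M) \<subseteq> I"
    unfolding A using mon_dvd_refl by (subst ideal_gen_mon_subset_iff) (auto simp: M_def)
  with sub have gen: "ideal_gen (mon ` M) = I" by blast
  have "ideal_gen (mon ` N) \<noteq> I" if N: "N \<subset> M" for N
  proof
    assume "ideal_gen (mon ` N) = I"
    then have *: "\<forall>a\<in>M. \<exists>b\<in>N. mon_dvd b a"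
      using gen ideal_gen_mon_subset_iff[of M N, where 'k='k] by simp
    obtain a where a: "a \<in> M" "a \<notin> N" using N by blast
    with * obtain b where "b \<in> N" "mon_dvd b a" by blast
    with a N show False unfolding M_def by blast
  qed
  with gen have M: "is_min_gens M I" unfolding is_min_gens_def by blast
  show ex: "\<exists>!M. is_min_gens M I"
  proof (rule ex1I[of _ M])
    show "is_min_gens M I" by (rule M)
  next
    fix N assume "is_min_gens N I"
    with M show "N = M" using min_gens_unique by (intro subset_antisym)
  qed
  then show "is_min_gens (min_gens I) I" unfolding min_gens_def by (rule theI')
qed

end

theory Submission
  imports Defs
begin

text \<open>
  All ideals in the statement are squarefree, and a squarefree monomial is the same thing as the set
  of vertices dividing it. Under this dictionary divisibility is inclusion and the least common
  multiple is the union. The ideal \<open>(x\<^sup>E) \<inter> \<I>(H \<setminus> E)\<close> is generated by the monomials of the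
  unions \<open>E \<union> F\<close> with \<open>F \<noteq> E\<close> an edge, and its minimal generators are those of the
  inclusion-minimal unions \<open>W\<close> (\<open>edge_ideal_Int\<close>, \<open>min_gens_edge_ideal\<close>).

  Since \<open>(x\<^sup>E)\<close> has one generator, the first splitting function is constant and its strictness
  condition is automatic: an edge other than \<open>E\<close> has a vertex outside \<open>E\<close>. So \<open>E\<close> is a splitting
  edge iff one can pick, for every minimal union \<open>W\<close>, an edge \<open>G W \<noteq> E\<close> with \<open>W = E \<union> G W\<close>, in such a
  way that for every nonempty family of minimal unions the picked edges do not cover the union of the
  family (\<open>splitting_edge_iff_choice\<close>).

  If such a \<open>G\<close> exists, apply the covering condition to the family of all minimal unions: some vertex
  \<open>z\<close> of a minimal union lies in no picked edge, and by \<open>W = E \<union> G W\<close> it lies in \<open>E\<close>. Every \<open>E \<union> F\<close>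
  contains a minimal \<open>W\<close>, hence the edge \<open>G W\<close>, which avoids \<open>z\<close>; this is the inclusion of ideals.
  Conversely, if the inclusion holds for \<open>z \<in> E\<close>, each minimal \<open>W\<close> contains an edge avoiding \<open>z\<close>, and
  minimality makes its union with \<open>E\<close> equal to \<open>W\<close>. Picking these edges leaves \<open>z\<close> uncovered in every
  family, although \<open>z\<close> belongs to every \<open>W\<close>.
\<close>

section \<open>Monomial ideals\<close>

lemma sum_single_lookup_keys:
  "(\<Sum>n\<in>Poly_Mapping.keys p. Poly_Mapping.single n (Poly_Mapping.lookup p n)) = p"
  by (rule poly_mapping_eqI)
    (simp add: lookup_sum lookup_single when_def not_in_keys_iff_lookup_eq_zero)

text \<open>
  A monomial ideal contains a polynomial iff it contains each of its monomials. This is what lets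
  intersections and inclusions of monomial ideals be read off from divisibility.
\<close>

lemma in_ideal_gen_mon_iff:
  fixes p :: "('x, 'k::field) mvpoly"
  shows "p \<in> ideal_gen (mon ` A) \<longleftrightarrow> (\<forall>n\<in>Poly_Mapping.keys p. \<exists>a\<in>A. mon_dvd a n)"
proof -
  interpret I: module "(*) :: ('x, 'k) mvpoly \<Rightarrow> _" by (rule module_mult)
  let ?P = "{p :: ('x, 'k) mvpoly. \<forall>n\<in>Poly_Mapping.keys p. \<exists>a\<in>A. mon_dvd a n}"
  have P: "I.subspace ?P"
  proof (rule I.subspaceI)
    show "0 \<in> ?P" by simp
    show "p + q \<in> ?P" if "p \<in> ?P" "q \<in> ?P" for p q
      using that keys_add[of p q] by blast
    show "c * p \<in> ?P" if "p \<in> ?P" for c p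
      using that keys_mult_mon[of _ c p] mon_dvd_trans by blast
  qed
  have "mon ` A \<subseteq> ?P"
    by (auto simp: mon_def mon_dvd_iff)
  then have "ideal_gen (mon ` A) \<subseteq> ?P"
    unfolding ideal_gen_def using P by (rule I.span_minimal)
  moreover have "p \<in> ideal_gen (mon ` A)"
    if *: "\<forall>n\<in>Poly_Mapping.keys p. \<exists>a\<in>A. mon_dvd a n"
  proof -
    have "Poly_Mapping.single n (Poly_Mapping.lookup p n) \<in> I.span (mon ` A)"
      if n: "n \<in> Poly_Mapping.keys p" for n
    proof -
      have "(mon n :: ('x, 'k) mvpoly) \<in> I.span (mon ` A)"
        using * n mon_in_ideal_gen_iff[of n A, where 'k='k] by (simp add: ideal_gen_def)
      then have "Poly_Mapping.single 0 (Poly_Mapping.lookup p n) * mon n \<in> I.span (mon ` A)"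
        by (rule I.span_scale)
      then show ?thesis by (simp add: mon_def mult_single)
    qed
    then have "(\<Sum>n\<in>Poly_Mapping.keys p. Poly_Mapping.single n (Poly_Mapping.lookup p n))
        \<in> I.span (mon ` A)"
      by (rule I.span_sum)
    then show ?thesis by (simp add: ideal_gen_def sum_single_lookup_keys)
  qed
  ultimately show ?thesis by blast
qed

lemma ideal_gen_Un: "ideal_gen (A \<union> B) = ideal_gen A + ideal_gen B"
proof -
  interpret I: module "(*) :: 'a::comm_ring_1 \<Rightarrow> _" by (rule module_mult)
  show ?thesis
    by (auto simp: ideal_gen_def I.span_Un set_plus_def)
qed

text \<open>
  Every generator is divisible by a divisibility-minimal one, so the minimal ones suffice; none can
  be omitted, because no other minimal one divides it.
\<close>

lemma min_gens_ideal_gen_mon: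
  fixes A :: "'x::finite monomial set"
  shows "min_gens (ideal_gen (mon ` A) :: ('x, 'k::field) mvpoly set)
    = {a\<in>A. \<forall>b\<in>A. mon_dvd b a \<longrightarrow> b = a}" (is "min_gens ?I = ?M")
proof -
  have "\<exists>b\<in>?M. mon_dvd b a" if "a \<in> A" for a
    using ex_minimal_divisor[OF that] by blast
  then have "?I \<subseteq> ideal_gen (mon ` ?M)"
    by (simp only: ideal_gen_mon_subset_iff) blast
  moreover have "ideal_gen (mon ` ?M) \<subseteq> ?I"
    unfolding ideal_gen_mon_subset_iff using mon_dvd_refl by blast
  ultimately have gen: "ideal_gen (mon ` ?M) = ?I" by blast
  have "ideal_gen (mon ` N) \<noteq> ?I" if N: "N \<subset> ?M" for N
  proof
    assume "ideal_gen (mon ` N) = ?I"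
    then have "\<forall>a\<in>?M. \<exists>b\<in>N. mon_dvd b a"
      using gen ideal_gen_mon_subset_iff[of ?M N, where 'k='k] by simp
    with N show False by blast
  qed
  with gen have "is_min_gens ?M ?I" unfolding is_min_gens_def by blast
  moreover have "is_min_gens (min_gens ?I) ?I"
    by (rule min_gens(2)) (auto simp: monomial_ideal_def)
  ultimately show ?thesis using min_gens_unique by blast
qed

section \<open>Squarefree monomials as sets of vertices\<close>

lemma lookup_edge_monomial:
  "Poly_Mapping.lookup (edge_monomial A) x = (if x \<in> A then 1 else 0)"
proof -
  have "Poly_Mapping.lookup (edge_monomial A) x = (\<Sum>y\<in>A. if y = x then 1 else 0)"
    unfolding edge_monomial_def
    by (induction A rule: finite_induct[OF finite])
      (auto simp: lookup_add lookup_single when_def)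
  then show ?thesis by simp
qed

lemma edge_monomial_dvd_iff: "mon_dvd (edge_monomial A) (edge_monomial B) \<longleftrightarrow> A \<subseteq> B"
  by (auto simp: mon_dvd_iff lookup_edge_monomial)

lemma edge_monomial_inject: "edge_monomial A = edge_monomial B \<longleftrightarrow> A = B"
  by (metis edge_monomial_dvd_iff mon_dvd_refl subset_antisym)

lemma edge_monomial_strict_dvd_iff:
  "mon_strict_dvd (edge_monomial A) (edge_monomial B) \<longleftrightarrow> A \<subset> B"
  by (auto simp: mon_strict_dvd_def edge_monomial_dvd_iff edge_monomial_inject)

lemma edge_monomial_Un_dvd_iff:
  "mon_dvd (edge_monomial (A \<union> B)) m \<longleftrightarrow>
    mon_dvd (edge_monomial A) m \<and> mon_dvd (edge_monomial B) m"
  by (auto simp: mon_dvd_iff lookup_edge_monomial)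

lemma mon_lcm_edge_monomial: "mon_lcm (edge_monomial ` \<A>) = edge_monomial (\<Union>\<A>)"
proof (rule mon_dvd_antisym)
  show "mon_dvd (mon_lcm (edge_monomial ` \<A>)) (edge_monomial (\<Union>\<A>))"
    by (auto simp: mon_lcm_dvd_iff edge_monomial_dvd_iff)
  have "\<forall>A\<in>\<A>. mon_dvd (edge_monomial A) (mon_lcm (edge_monomial ` \<A>))"
    using mon_lcm_dvd_iff[of "edge_monomial ` \<A>" "mon_lcm (edge_monomial ` \<A>)"]
    by (simp add: mon_dvd_refl)
  then show "mon_dvd (edge_monomial (\<Union>\<A>)) (mon_lcm (edge_monomial ` \<A>))"
    unfolding mon_dvd_iff lookup_edge_monomial by (metis UnionE le0)
qed

lemma mon_lcm_edge_monomial_pair: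
  "mon_lcm {edge_monomial A, edge_monomial B} = edge_monomial (A \<union> B)"
  using mon_lcm_edge_monomial[of "{A, B}"] by simp

section \<open>Ideals generated by families of sets\<close>

lemma edge_ideal_eq: "edge_ideal \<A> = ideal_gen (mon ` edge_monomial ` \<A>)"
  by (simp add: edge_ideal_def image_image)

lemma monomial_ideal_edge_ideal: "monomial_ideal (edge_ideal \<A>)"
  unfolding monomial_ideal_def edge_ideal_eq by blast

lemma edge_ideal_Un: "edge_ideal (\<A> \<union> \<B>) = edge_ideal \<A> + edge_ideal \<B>"
  by (simp add: edge_ideal_def image_Un ideal_gen_Un)

lemma edge_ideal_nonzero:
  assumes "\<A> \<noteq> {}"
  shows "(edge_ideal \<A> :: ('x::finite, 'k::field) mvpoly set) \<noteq> {0}"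
proof
  assume zero: "(edge_ideal \<A> :: ('x, 'k) mvpoly set) = {0}"
  obtain A where "A \<in> \<A>" using assms by blast
  then have "(mon (edge_monomial A) :: ('x, 'k) mvpoly) \<in> edge_ideal \<A>"
    unfolding edge_ideal_eq mon_in_ideal_gen_iff using mon_dvd_refl by blast
  then have "(mon (edge_monomial A) :: ('x, 'k) mvpoly) = 0"
    by (simp add: zero)
  then have "Poly_Mapping.keys (mon (edge_monomial A) :: ('x, 'k) mvpoly) = {}" by simp
  then show False by (simp add: mon_def)
qed

lemma edge_ideal_subset_iff:
  "(edge_ideal \<A> :: ('x::finite, 'k::field) mvpoly set) \<subseteq> edge_ideal \<B> \<longleftrightarrow>
    (\<forall>A\<in>\<A>. \<exists>B\<in>\<B>. B \<subseteq> A)"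
  by (simp add: edge_ideal_eq ideal_gen_mon_subset_iff edge_monomial_dvd_iff)

text \<open>
  A monomial lies in both ideals iff it is divisible by some \<open>x\<^sup>A\<close> and some \<open>x\<^sup>B\<close>, that is, by the
  least common multiple of the two, which is the monomial of \<open>A \<union> B\<close>.
\<close>

lemma edge_ideal_Int:
  "(edge_ideal \<A> :: ('x::finite, 'k::field) mvpoly set) \<inter> edge_ideal \<B> =
    edge_ideal {A \<union> B | A B. A \<in> \<A> \<and> B \<in> \<B>}"
proof (rule set_eqI)
  fix p :: "('x, 'k) mvpoly"
  have "(\<exists>A\<in>\<A>. mon_dvd (edge_monomial A) n) \<and> (\<exists>B\<in>\<B>. mon_dvd (edge_monomial B) n) \<longleftrightarrow>
      (\<exists>W\<in>{A \<union> B | A B. A \<in> \<A> \<and> B \<in> \<B>}. mon_dvd (edge_monomial W) n)" for n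
    using edge_monomial_Un_dvd_iff by blast
  then show "p \<in> edge_ideal \<A> \<inter> edge_ideal \<B> \<longleftrightarrow>
      p \<in> edge_ideal {A \<union> B | A B. A \<in> \<A> \<and> B \<in> \<B>}"
    unfolding edge_ideal_eq Int_iff in_ideal_gen_mon_iff by (simp only: bex_simps) blast
qed

definition minimal_members :: "'a set set \<Rightarrow> 'a set set" where
  "minimal_members \<A> = {A \<in> \<A>. \<forall>B\<in>\<A>. B \<subseteq> A \<longrightarrow> B = A}"

lemma minimal_members_antichain:
  assumes "\<And>A B. A \<in> \<A> \<Longrightarrow> B \<in> \<A> \<Longrightarrow> A \<subseteq> B \<Longrightarrow> A = B"
  shows "minimal_members \<A> = \<A>"
  using assms by (auto simp: minimal_members_def)

lemma ex_minimal_member_subset: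
  fixes \<A> :: "'x::finite set set"
  assumes "A \<in> \<A>"
  shows "\<exists>B\<in>minimal_members \<A>. B \<subseteq> A"
  using finite_has_minimal2[OF finite assms] by (auto simp: minimal_members_def)

lemma min_gens_edge_ideal:
  "min_gens (edge_ideal \<A> :: ('x::finite, 'k::field) mvpoly set) =
    edge_monomial ` minimal_members \<A>"
  unfolding edge_ideal_eq min_gens_ideal_gen_mon
  by (auto simp: minimal_members_def edge_monomial_dvd_iff edge_monomial_inject)

section \<open>Splitting edges\<close>

definition edge_unions :: "'x set set \<Rightarrow> 'x set \<Rightarrow> 'x set set" where
  "edge_unions H E = (\<lambda>F. E \<union> F) ` delete_edge H E"

lemma delete_edge_nonempty:
  assumes "card H \<ge> 2"
  shows "delete_edge H E \<noteq> {}"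
proof
  assume "delete_edge H E = {}"
  then have "H \<subseteq> {E}" by (auto simp: delete_edge_def)
  then have "card H \<le> 1" using card_mono[of "{E}" H] by simp
  with assms show False by simp
qed

lemma edge_ideal_Int_delete_edge:
  "(ideal_gen {mon (edge_monomial E)} :: ('x::finite, 'k::field) mvpoly set)
      \<inter> edge_ideal (delete_edge H E) = edge_ideal (edge_unions H E)"
proof -
  have "ideal_gen {mon (edge_monomial E)} = (edge_ideal {E} :: ('x, 'k) mvpoly set)"
    by (simp add: edge_ideal_def)
  moreover have "{A \<union> B | A B. A \<in> {E} \<and> B \<in> delete_edge H E} = edge_unions H E"
    by (auto simp: edge_unions_def)
  ultimately show ?thesis by (simp only: edge_ideal_Int)
qed

text \<open>
  The existence of the two splitting functions on monomials becomes the existence of one choice of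
  edges: the first function is forced to be constant, and \<open>E\<close> is properly contained in every union
  \<open>E \<union> F\<close> because edges are incomparable.
\<close>

lemma splitting_edge_iff_choice:
  fixes H :: "'x::finite set set"
  assumes simple: "simple_hypergraph H" and card: "card H \<ge> 2" and E: "E \<in> H"
  shows "splitting_edge TYPE('k::field) H E \<longleftrightarrow>
    (\<exists>G. (\<forall>W\<in>minimal_members (edge_unions H E). G W \<in> delete_edge H E \<and> W = E \<union> G W) \<and>
         (\<forall>\<S>. \<S> \<subseteq> minimal_members (edge_unions H E) \<and> \<S> \<noteq> {} \<longrightarrow> \<Union>(G ` \<S>) \<subset> \<Union>\<S>))"
    (is "?L \<longleftrightarrow> (\<exists>G. ?C G)")
proof -
  let ?M = "minimal_members (edge_unions H E)"
  let ?J = "ideal_gen {mon (edge_monomial E)} :: ('x, 'k) mvpoly set"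
  let ?K = "edge_ideal (delete_edge H E) :: ('x, 'k) mvpoly set"
  have J: "?J = edge_ideal {E}" by (simp add: edge_ideal_def)
  have anti: "A = B" if "A \<in> H" "B \<in> H" "A \<subseteq> B" for A B
    using simple that unfolding simple_hypergraph_def by blast
  have ne: "delete_edge H E \<noteq> {}" using card by (rule delete_edge_nonempty)
  have H: "H = {E} \<union> delete_edge H E" using E by (auto simp: delete_edge_def)
  have gens: "min_gens (edge_ideal \<A> :: ('x, 'k) mvpoly set) = edge_monomial ` \<A>" if "\<A> \<subseteq> H" for \<A>
  proof -
    have "minimal_members \<A> = \<A>"
      using anti that by (intro minimal_members_antichain) blast
    then show ?thesis by (simp add: min_gens_edge_ideal)
  qed
  have gensJ: "min_gens ?J = {edge_monomial E}" using E by (simp add: J gens)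
  have gensK: "min_gens ?K = edge_monomial ` delete_edge H E"
    by (rule gens) (auto simp: delete_edge_def)
  have gensJK: "min_gens (?J \<inter> ?K) = edge_monomial ` ?M"
    by (simp add: edge_ideal_Int_delete_edge min_gens_edge_ideal)
  have "edge_ideal H = ?J + ?K"
    unfolding J edge_ideal_Un[symmetric] using H by simp
  moreover have "min_gens (edge_ideal H :: ('x, 'k) mvpoly set) = min_gens ?J \<union> min_gens ?K"
    unfolding gensJ gensK using H by (metis gens image_Un image_empty image_insert subset_refl)
  moreover have "min_gens ?J \<inter> min_gens ?K = {}"
    unfolding gensJ gensK by (auto simp: edge_monomial_inject delete_edge_def)
  moreover have "?J \<noteq> {0}" "monomial_ideal ?J"
    unfolding J by (simp_all add: edge_ideal_nonzero monomial_ideal_edge_ideal)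
  moreover have "?K \<noteq> {0}" "monomial_ideal ?K"
    using ne by (simp_all add: edge_ideal_nonzero monomial_ideal_edge_ideal)
  ultimately have L: "?L \<longleftrightarrow> (\<exists>\<phi> \<psi>.
        (\<forall>w \<in> edge_monomial ` ?M. \<phi> w \<in> {edge_monomial E} \<and>
           \<psi> w \<in> edge_monomial ` delete_edge H E \<and> w = mon_lcm {\<phi> w, \<psi> w}) \<and>
        (\<forall>S. S \<subseteq> edge_monomial ` ?M \<and> S \<noteq> {} \<longrightarrow>
           mon_strict_dvd (mon_lcm (\<phi> ` S)) (mon_lcm S) \<and>
           mon_strict_dvd (mon_lcm (\<psi> ` S)) (mon_lcm S)))" (is "_ \<longleftrightarrow> (\<exists>\<phi> \<psi>. ?S \<phi> \<psi>)")
    unfolding splitting_edge_def is_splitting_def gensJK using E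
    by (simp add: gensJ gensK)
  have proper: "E \<subset> W" if "W \<in> ?M" for W
    using that anti E by (auto simp: minimal_members_def edge_unions_def delete_edge_def)
  show ?thesis
  proof
    assume ?L
    then obtain \<phi> \<psi> where S: "?S \<phi> \<psi>" using L by blast
    then have "\<forall>W\<in>?M. \<exists>F. F \<in> delete_edge H E \<and> \<psi> (edge_monomial W) = edge_monomial F"
      by auto
    then obtain G where G: "\<And>W. W \<in> ?M \<Longrightarrow> G W \<in> delete_edge H E"
      "\<And>W. W \<in> ?M \<Longrightarrow> \<psi> (edge_monomial W) = edge_monomial (G W)"
      by metis
    have "W = E \<union> G W" if "W \<in> ?M" for W
    proof -
      have "edge_monomial W = mon_lcm {edge_monomial E, edge_monomial (G W)}"
        using S that G(2)[OF that] by auto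
      then show ?thesis by (simp add: mon_lcm_edge_monomial_pair edge_monomial_inject)
    qed
    moreover have "\<Union>(G ` \<S>) \<subset> \<Union>\<S>" if \<S>: "\<S> \<subseteq> ?M" "\<S> \<noteq> {}" for \<S>
    proof -
      have "\<psi> ` edge_monomial ` \<S> = edge_monomial ` G ` \<S>"
        unfolding image_image using G(2) \<S>(1) by (intro image_cong) auto
      moreover have "mon_strict_dvd (mon_lcm (\<psi> ` edge_monomial ` \<S>)) (mon_lcm (edge_monomial ` \<S>))"
        using S \<S> by (metis image_is_empty image_mono)
      ultimately show ?thesis
        by (simp only: mon_lcm_edge_monomial edge_monomial_strict_dvd_iff)
    qed
    ultimately have "?C G" using G(1) by simp
    then show "\<exists>G. ?C G" by (rule exI[of _ G])
  next
    assume "\<exists>G. ?C G"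
    then obtain G where G: "?C G" ..
    define \<phi> :: "'x monomial \<Rightarrow> 'x monomial" where "\<phi> = (\<lambda>w. edge_monomial E)"
    define \<psi> :: "'x monomial \<Rightarrow> 'x monomial"
      where "\<psi> = (\<lambda>w. edge_monomial (G (inv edge_monomial w)))"
    have \<psi>: "\<psi> (edge_monomial W) = edge_monomial (G W)" for W
      by (simp add: \<psi>_def inv_f_f inj_def edge_monomial_inject)
    have "?S \<phi> \<psi>"
    proof (intro conjI ballI allI impI)
      fix w assume "w \<in> edge_monomial ` ?M"
      then obtain W where W: "W \<in> ?M" "w = edge_monomial W" by blast
      then have GW: "G W \<in> delete_edge H E" "W = E \<union> G W"
        using conjunct1[OF G] by simp_all
      show "\<phi> w \<in> {edge_monomial E}" by (simp add: \<phi>_def)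
      show "\<psi> w \<in> edge_monomial ` delete_edge H E" using GW W \<psi> by simp
      show "w = mon_lcm {\<phi> w, \<psi> w}"
        using GW(2) by (simp add: W \<psi> \<phi>_def mon_lcm_edge_monomial_pair edge_monomial_inject)
    next
      fix S assume "S \<subseteq> edge_monomial ` ?M \<and> S \<noteq> {}"
      then obtain \<S> where \<S>: "\<S> \<subseteq> ?M" "S = edge_monomial ` \<S>" "\<S> \<noteq> {}"
        by (auto simp: subset_image_iff)
      have "\<phi> ` S = edge_monomial ` {E}" using \<S> by (auto simp: \<phi>_def)
      moreover have "E \<subset> \<Union>\<S>" using \<S> proper by blast
      ultimately show "mon_strict_dvd (mon_lcm (\<phi> ` S)) (mon_lcm S)"
        using \<S>(2) by (simp only: mon_lcm_edge_monomial edge_monomial_strict_dvd_iff) simp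
      have "\<psi> ` S = edge_monomial ` G ` \<S>" by (simp add: \<S>(2) image_image \<psi>)
      moreover have "\<Union>(G ` \<S>) \<subset> \<Union>\<S>"
        using conjunct2[OF G, rule_format, of \<S>] \<S> by simp
      ultimately show "mon_strict_dvd (mon_lcm (\<psi> ` S)) (mon_lcm S)"
        using \<S>(2) by (simp only: mon_lcm_edge_monomial edge_monomial_strict_dvd_iff)
    qed
    then show ?L using L by blast
  qed
qed

theorem theorem1p1:
  fixes H :: "'x::finite set set" and E :: "'x set"
  assumes "simple_hypergraph H" and "card H \<ge> 2" and "E \<in> H"
  shows "splitting_edge TYPE('k::field) H E \<longleftrightarrow>
    (\<exists>z \<in> E.
       (ideal_gen {mon (edge_monomial E)} :: ('x, 'k) mvpoly set) \<inter> edge_ideal (delete_edge H E)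
         \<subseteq> ideal_gen {mon (edge_monomial E)} \<inter> edge_ideal (delete_vertex H z))"
proof -
  let ?M = "minimal_members (edge_unions H E)"
  let ?J = "ideal_gen {mon (edge_monomial E)} :: ('x, 'k) mvpoly set"
  have incl: "?J \<inter> edge_ideal (delete_edge H E) \<subseteq> ?J \<inter> edge_ideal (delete_vertex H z) \<longleftrightarrow>
      (\<forall>W\<in>?M. \<exists>F\<in>delete_vertex H z. F \<subseteq> W)" (is "?I \<longleftrightarrow> ?R") for z
  proof -
    have "?I \<longleftrightarrow> ?J \<inter> edge_ideal (delete_edge H E) \<subseteq> edge_ideal (delete_vertex H z)" by blast
    also have "\<dots> \<longleftrightarrow> (\<forall>W\<in>edge_unions H E. \<exists>F\<in>delete_vertex H z. F \<subseteq> W)"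
      by (simp only: edge_ideal_Int_delete_edge edge_ideal_subset_iff)
    also have "\<dots> \<longleftrightarrow> ?R"
    proof
      assume R: ?R
      show "\<forall>W\<in>edge_unions H E. \<exists>F\<in>delete_vertex H z. F \<subseteq> W"
        using R ex_minimal_member_subset by (metis subset_trans)
    qed (simp add: minimal_members_def)
    finally show ?thesis .
  qed
  have "edge_unions H E \<noteq> {}"
    using delete_edge_nonempty[OF assms(2)] by (simp add: edge_unions_def)
  then have "?M \<noteq> {}" using ex_minimal_member_subset by blast
  have "splitting_edge TYPE('k) H E \<longleftrightarrow> (\<exists>z\<in>E. \<forall>W\<in>?M. \<exists>F\<in>delete_vertex H z. F \<subseteq> W)"
    unfolding splitting_edge_iff_choice[OF assms]
  proof (intro iffI; elim exE bexE conjE)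
    fix G assume G: "\<forall>W\<in>?M. G W \<in> delete_edge H E \<and> W = E \<union> G W"
      and cover: "\<forall>\<S>. \<S> \<subseteq> ?M \<and> \<S> \<noteq> {} \<longrightarrow> \<Union>(G ` \<S>) \<subset> \<Union>\<S>"
    (* One family is enough: that of all minimal unions yields a single z for every W. *)
    have "\<Union>(G ` ?M) \<subset> \<Union>?M" using cover[rule_format, of ?M] \<open>?M \<noteq> {}\<close> by simp
    then obtain z W where z: "W \<in> ?M" "z \<in> W" "z \<notin> \<Union>(G ` ?M)" by blast
    (* z lies in W = E \<union> G W but not in G W *)
    then have "z \<in> E" using G by blast
    moreover have "\<forall>W\<in>?M. \<exists>F\<in>delete_vertex H z. F \<subseteq> W"
    proof
      fix W assume W: "W \<in> ?M"
      then have "G W \<in> delete_vertex H z"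
        using G z(3) by (auto simp: delete_vertex_def delete_edge_def)
      moreover have "G W \<subseteq> W" using G W by blast
      ultimately show "\<exists>F\<in>delete_vertex H z. F \<subseteq> W" ..
    qed
    ultimately show "\<exists>z\<in>E. \<forall>W\<in>?M. \<exists>F\<in>delete_vertex H z. F \<subseteq> W" ..
  next
    fix z assume z: "z \<in> E" and "\<forall>W\<in>?M. \<exists>F\<in>delete_vertex H z. F \<subseteq> W"
    then obtain G where G: "\<And>W. W \<in> ?M \<Longrightarrow> G W \<in> delete_vertex H z"
      "\<And>W. W \<in> ?M \<Longrightarrow> G W \<subseteq> W"
      by metis
    (* E contains z, so an edge that avoids z is automatically different from E. *)
    have edge: "G W \<in> delete_edge H E" if "W \<in> ?M" for W
      using G(1)[OF that] z by (auto simp: delete_vertex_def delete_edge_def)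
    have EW: "E \<subseteq> W" if "W \<in> ?M" for W
      using that by (auto simp: minimal_members_def edge_unions_def)
    have "W = E \<union> G W" if W: "W \<in> ?M" for W
    proof -
      have "E \<union> G W \<in> edge_unions H E" using edge[OF W] by (simp add: edge_unions_def)
      moreover have "E \<union> G W \<subseteq> W" using EW G(2) W by blast
      ultimately show ?thesis using W by (auto simp: minimal_members_def)
    qed
    moreover have "\<Union>(G ` \<S>) \<subset> \<Union>\<S>" if \<S>: "\<S> \<subseteq> ?M" "\<S> \<noteq> {}" for \<S>
    proof
      show "\<Union>(G ` \<S>) \<subseteq> \<Union>\<S>" using G(2) \<S> by blast
      have "z \<in> \<Union>\<S>" using \<S> EW z by blast
      moreover have "z \<notin> \<Union>(G ` \<S>)" using G(1) \<S>(1) by (auto simp: delete_vertex_def)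
      ultimately show "\<Union>(G ` \<S>) \<noteq> \<Union>\<S>" by blast
    qed
    ultimately show "\<exists>G. (\<forall>W\<in>?M. G W \<in> delete_edge H E \<and> W = E \<union> G W) \<and>
        (\<forall>\<S>. \<S> \<subseteq> ?M \<and> \<S> \<noteq> {} \<longrightarrow> \<Union>(G ` \<S>) \<subset> \<Union>\<S>)"
      using edge by (intro exI[of _ G]) simp
  qed
  then show ?thesis by (simp only: incl)
qed

end
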